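(* Let $K_1$ and $K_2$ be nonempty convex sets in $\mathbb{R}^n$, let $r$ and $m$ be integers, and let $S \subset \mathbb{R}^n$ be a linear subspace of dimension $r$. Assume that one of the following holds: (a) $K_1$ and $K_2$ are both compact and $0 \le r \le m-2 \le n-3$; or (b) $K_1$ and $K_2$ are both closed and $0 \le r \le m-3 \le n-4$. Then the following two conditions are equivalent: 1) $K_1$ and $K_2$ are homothetic; 2) for every $m$-dimensional plane $L \subset \mathbb{R}^n$ that contains $S$, the orthogonal projections $\pi_L(K_1)$ and $\pi_L(K_2)$ are homothetic, where the homothety ratio may depend on $L$.
   Context: Nonempty sets $X_1, X_2 \subset \mathbb{R}^n$ are called homothetic if $X_1 = z + \lambda X_2$ for some point $z \in \mathbb{R}^n$ and some scalar $\lambda \neq 0$ (the homothety ratio); $\lambda$ is not required to be positive. A plane in $\mathbb{R}^n$ is a set of the form $z + L_0$, where $z \in \mathbb{R}^n$ and $L_0$ is a linear subspace of $\mathbb{R}^n$; its dimension is that of $L_0$. For a plane $L \subset \mathbb{R}^n$ and a set $X \subset \mathbb{R}^n$, $\pi_L(X)$ denotes the orthogonal projection of $X$ on $L$. *)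

theory Defs
  imports "HOL-Analysis.Analysis"
begin

definition homothetic :: "'a::real_vector set \<Rightarrow> 'a set \<Rightarrow> bool" where
  "homothetic X1 X2 \<longleftrightarrow> X1 \<noteq> {} \<and> X2 \<noteq> {} \<and>
     (\<exists>z lam. lam \<noteq> 0 \<and> X1 = (\<lambda>x. z + lam *\<^sub>R x) ` X2)"

definition plane_of_dim :: "int \<Rightarrow> 'a::euclidean_space set \<Rightarrow> bool" where
  "plane_of_dim d L \<longleftrightarrow>
     (\<exists>z L0. subspace L0 \<and> int (dim L0) = d \<and> L = (+) z ` L0)"

text \<open>Orthogonal projection of a point on a plane: the foot of the perpendicular.
  Existence and uniqueness for planes is \<open>ex1_orth_proj\<close> below; the value is
  meaningless for other sets.\<close>

definition orth_proj :: "'a::euclidean_space set \<Rightarrow> 'a \<Rightarrow> 'a" where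
  "orth_proj L x = (THE p. p \<in> L \<and> (\<forall>q\<in>L. orthogonal (x - p) (q - p)))"

lemma plane_of_dim_iff_affine:
  "plane_of_dim d L \<longleftrightarrow> affine L \<and> L \<noteq> {} \<and> aff_dim L = d"
proof
  assume "plane_of_dim d L"
  then obtain z L0 where *: "subspace L0" "int (dim L0) = d" "L = (+) z ` L0"
    unfolding plane_of_dim_def by blast
  have "L0 \<noteq> {}"
    using * subspace_0 by blast
  moreover have "aff_dim L = d"
    using * by (simp add: aff_dim_translation_eq aff_dim_subspace)
  moreover have "affine L"
    using * subspace_imp_affine affine_translation by blast
  ultimately show "affine L \<and> L \<noteq> {} \<and> aff_dim L = d"
    using * by simp
next
  assume *: "affine L \<and> L \<noteq> {} \<and> aff_dim L = d"
  then obtain z where z: "z \<in> L" by blast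
  define L0 where "L0 = (+) (- z) ` L"
  have sub: "subspace L0"
    using affine_diffs_subspace[of L z] * z by (simp add: L0_def)
  have L: "L = (+) z ` L0"
    by (simp add: L0_def image_image)
  have "int (dim L0) = d"
    using * sub by (metis L aff_dim_translation_eq aff_dim_subspace)
  with sub L show "plane_of_dim d L"
    unfolding plane_of_dim_def by blast
qed

lemma ex1_orth_proj:
  fixes x :: "'a::euclidean_space"
  assumes "plane_of_dim d L"
  shows "\<exists>!p. p \<in> L \<and> (\<forall>q\<in>L. orthogonal (x - p) (q - p))"
proof -
  obtain z L0 where *: "subspace L0" "L = (+) z ` L0"
    using assms unfolding plane_of_dim_def by blast
  obtain y w where yw: "y \<in> span L0" "\<And>v. v \<in> span L0 \<Longrightarrow> orthogonal w v" "x - z = y + w"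
    using orthogonal_subspace_decomp_exists[of L0 "x - z"] by metis
  show ?thesis
  proof (rule ex1I[of _ "z + y"])
    have "orthogonal (x - (z + y)) (q - (z + y))" if q: "q \<in> L" for q
    proof -
      obtain v where v: "v \<in> L0" "q = z + v"
        using * q by blast
      have "v - y \<in> span L0"
        using v yw by (simp add: span_base span_diff)
      moreover have "x - (z + y) = w" "q - (z + y) = v - y"
        using yw(3) v by (auto simp: algebra_simps)
      ultimately show ?thesis
        using yw(2) by metis
    qed
    moreover have "z + y \<in> L"
      using * yw(1) by (metis imageI span_eq_iff)
    ultimately show "z + y \<in> L \<and> (\<forall>q\<in>L. orthogonal (x - (z + y)) (q - (z + y)))"
      by blast
    fix p
    assume p: "p \<in> L \<and> (\<forall>q\<in>L. orthogonal (x - p) (q - p))"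
    have 1: "(x - p) \<bullet> (z + y - p) = 0" "(x - (z + y)) \<bullet> (p - (z + y)) = 0"
      using p \<open>z + y \<in> L\<close> \<open>\<And>q. q \<in> L \<Longrightarrow> orthogonal (x - (z + y)) (q - (z + y))\<close>
      unfolding orthogonal_def by blast+
    have "(p - (z + y)) \<bullet> (p - (z + y))
        = (x - p) \<bullet> (z + y - p) + (x - (z + y)) \<bullet> (p - (z + y))"
      by (simp add: algebra_simps inner_commute)
    with 1 show "p = z + y" by simp
  qed
qed

end

theory Submission imports Defs begin

text \<open>For \<open>u\<close> in a subspace \<open>L\<close>, the sets \<open>K\<close> and \<open>\<pi>\<^sub>L(K)\<close> have the same supremum of
\<open>u \<bullet> x\<close>. Hence homothety of the projections on \<open>L\<close> gives
\<open>h\<^sub>1(u) = z \<bullet> u + h\<^sub>2(c u)\<close> for \<open>u \<in> L\<close>, where \<open>h\<^sub>1\<close>, \<open>h\<^sub>2\<close> are the support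
functions (\<open>support_homothetic_on_of_projections\<close>); a negative ratio \<open>c\<close> needs no separate
treatment in this form. Closed convex sets are determined by their support functions, so it is
enough to find one pair \<open>(z, c)\<close> that is good for all \<open>u\<close> (\<open>homothetic_of_support\<close>). The bounds
on \<open>r\<close> and \<open>m\<close> say that \<open>L\<close> can be made to contain any two given vectors in the compact case and
any three in the closed case, so that \<open>S\<close> and \<open>m\<close> disappear from the problem.

Suppose first that \<open>h\<^sub>1\<close>, \<open>h\<^sub>2\<close> are finite everywhere (\<open>sublinear_homothetic_of_pairs\<close>). The widths
\<open>w\<^sub>i(u) = h\<^sub>i(u) + h\<^sub>i(-u)\<close> do not see \<open>z\<close> or the sign of \<open>c\<close>, so \<open>w\<^sub>1 = \<bar>c\<bar> w\<^sub>2\<close> on \<open>L\<close>, and comparing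
two vectors in a common \<open>L\<close> shows that \<open>\<bar>c\<bar>\<close> is a constant \<open>\<mu>\<close>. Only the sign can still depend
on \<open>L\<close>: of the odd functions \<open>d(u) = h\<^sub>1(u) - h\<^sub>2(\<mu> u)\<close> and \<open>e(u) = h\<^sub>1(u) - h\<^sub>2(-\<mu> u)\<close>, at least one
is linear on each plane through the origin. The key point is \<open>functional_dichotomy\<close>: then one of
them is linear on the whole space. If \<open>d(x + y) \<noteq> d(x) + d(y)\<close>, then by continuity \<open>e\<close> is linear on
all planes spanned by vectors near \<open>x\<close> and near \<open>y\<close>, and this already forces \<open>e\<close> to agree with
one linear functional \<open>z\<close> near each of \<open>x\<close>, \<open>y\<close>, \<open>x + y\<close>. Symmetrically, if \<open>e\<close> is not additive at
\<open>x'\<close>, \<open>y'\<close>, then \<open>d\<close> agrees with some \<open>z'\<close> near \<open>x'\<close>, \<open>y'\<close>, \<open>x' + y'\<close>. Take \<open>a\<close> among the first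
three points with \<open>d(a) \<noteq> z' \<bullet> a\<close> and \<open>b\<close> among the other three with \<open>e(b) \<noteq> z \<bullet> b\<close>. On the span of \<open>a\<close>
and \<open>b\<close>, linearity of \<open>e\<close> would spread \<open>e = z\<close> from a neighbourhood of \<open>a\<close> to \<open>b\<close>, and linearity
of \<open>d\<close> would spread \<open>d = z'\<close> from \<open>b\<close> to \<open>a\<close>; both are excluded.

For closed sets, \<open>h\<^sub>i\<close> is finite on a convex cone \<open>B\<^sub>i\<close>, the barrier cone, and the hypothesis forces
\<open>B\<^sub>1 = B\<^sub>2\<close> or \<open>B\<^sub>1 = - B\<^sub>2\<close>; reflecting \<open>K\<^sub>2\<close>, one may take \<open>B\<^sub>1 = B\<^sub>2 = B\<close>. If \<open>B\<close> is a subspace, the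
previous case applies inside \<open>B\<close>. Otherwise widths are useless, but now any \<open>x \<in> B\<close> with
\<open>-x \<notin> B\<close> makes \<open>c\<close> positive on every subspace containing \<open>x\<close>
(\<open>sublinear_homothetic_of_triples\<close>). The ratio is read off from the convexity deficits
\<open>H\<^sub>i(u, v) = h\<^sub>i(u) + h\<^sub>i(v) - h\<^sub>i(u + v)\<close>, since \<open>H\<^sub>1 = c H\<^sub>2\<close> on each \<open>L\<close>; two pairs with nonzero deficit
are joined by a chain of pairs in which neighbours lie in a common three-dimensional
subspace, so \<open>c\<close> is the same for all pairs. Then \<open>h\<^sub>1 - c h\<^sub>2\<close> is additive on \<open>B\<close>, hence of the form
\<open>z \<bullet> u\<close>.\<close>

section \<open>Linear functionals on subsets\<close>

definition functional_on :: "'a::real_inner set \<Rightarrow> ('a \<Rightarrow> real) \<Rightarrow> bool" where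
  "functional_on W f \<longleftrightarrow> (\<exists>z. \<forall>w\<in>W. f w = z \<bullet> w)"

text \<open>A functional with the values of \<open>g\<close> on a basis chosen inside \<open>B\<close> is the only candidate. Since the
coefficients of an element of \<open>B\<close> in that basis may be negative, the comparison is made on
differences \<open>a - b\<close> of elements of the cone, which exhaust the span of \<open>B\<close>.\<close>

lemma additive_on_convex_cone_functional:
  fixes g :: "'a::euclidean_space \<Rightarrow> real"
  assumes B: "convex_cone B"
    and add: "\<And>x y. x \<in> B \<Longrightarrow> y \<in> B \<Longrightarrow> g (x + y) = g x + g y"
    and scale: "\<And>c x. x \<in> B \<Longrightarrow> c \<ge> 0 \<Longrightarrow> g (c *\<^sub>R x) = c * g x"
  shows "functional_on B g"
proof -
  obtain C where C: "C \<subseteq> B" "independent C" "B \<subseteq> span C"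
    using maximal_independent_subset by blast
  obtain F where F: "linear F" "\<And>x. x \<in> C \<Longrightarrow> F x = g x"
    using linear_independent_extend[OF C(2), of g] by blast
  have g0: "g 0 = 0" "0 \<in> B"
    using scale[of 0 0] convex_cone_contains_0[OF B] by auto
  have diff: "\<exists>a b. a \<in> B \<and> b \<in> B \<and> x + b = a \<and> F x + g b = g a" if "x \<in> span C" for x
    using that
  proof (induction rule: span_induct_alt)
    case base
    show ?case using g0 linear_0[OF F(1)] by force
  next
    case (step c x y)
    then obtain a b where ab: "a \<in> B" "b \<in> B" "y + b = a" "F y + g b = g a" by blast
    have x: "x \<in> B" and Fx: "F (c *\<^sub>R x + y) = c * g x + F y"
      using step C F by (auto simp: linear_add linear_scale)
    show ?case
    proof (cases "c \<ge> 0")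
      case True
      have m: "c *\<^sub>R x \<in> B" using True x B convex_cone_scaleR by blast
      have m2: "c *\<^sub>R x + a \<in> B" using m ab B convex_cone_add by blast
      have "(c *\<^sub>R x + y) + b = c *\<^sub>R x + a"
        "F (c *\<^sub>R x + y) + g b = g (c *\<^sub>R x + a)"
        using ab Fx add[OF m ab(1)] scale[OF x True] by auto
      then show ?thesis using m2 ab by blast
    next
      case False
      then have c: "- c \<ge> 0" by simp
      have m: "(- c) *\<^sub>R x \<in> B" using c x B convex_cone_scaleR by blast
      have m2: "(- c) *\<^sub>R x + b \<in> B" using m ab B convex_cone_add by blast
      have "(c *\<^sub>R x + y) + ((- c) *\<^sub>R x + b) = a"
        "F (c *\<^sub>R x + y) + g ((- c) *\<^sub>R x + b) = g a"
        using ab Fx add[OF m ab(2)] scale[OF x c] by (auto simp: algebra_simps)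
      then show ?thesis using m2 ab by blast
    qed
  qed
  have "g x = F x" if x: "x \<in> B" for x
  proof -
    obtain a b where "a \<in> B" "b \<in> B" "x + b = a" "F x + g b = g a"
      using diff[of x] x C(3) by blast
    then show ?thesis using add[OF x] by fastforce
  qed
  moreover have "F x = adjoint F 1 \<bullet> x" for x
    using adjoint_works[OF F(1), of x 1] by (simp add: inner_commute)
  ultimately show ?thesis unfolding functional_on_def by metis
qed

lemma functional_on_span_pairD:
  assumes "functional_on (span {x, y}) f"
  shows "f (s *\<^sub>R x + t *\<^sub>R y) = s * f x + t * f y"
proof -
  obtain z where z: "\<forall>w\<in>span {x, y}. f w = z \<bullet> w"
    using assms unfolding functional_on_def by blast
  have "x \<in> span {x, y}" "y \<in> span {x, y}" "s *\<^sub>R x + t *\<^sub>R y \<in> span {x, y}"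
    by (auto intro: span_base span_add span_scale)
  then show ?thesis using z by (simp add: inner_add_right)
qed

lemma linear_functional_on_UNIV:
  fixes f :: "'a::euclidean_space \<Rightarrow> real"
  assumes "\<And>c x. f (c *\<^sub>R x) = c * f x" and "\<And>x y. f (x + y) = f x + f y"
  shows "functional_on UNIV f"
  using additive_on_convex_cone_functional[of UNIV f] assms
  by (simp add: convex_cone_iff)

section \<open>The dichotomy for functions linear on planes\<close>

lemma mem_cone_hull_ball:
  "p \<in> cone hull (ball x \<delta>) \<longleftrightarrow> (\<exists>c q. c \<ge> 0 \<and> q \<in> ball x \<delta> \<and> p = c *\<^sub>R q)"
  unfolding cone_hull_expl by blast

lemma convex_cone_cone_hull_ball:
  fixes x :: "'a::real_normed_vector"
  assumes "\<delta> > 0" shows "convex_cone (cone hull (ball x \<delta>))"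
proof -
  have c: "convex (cone hull (ball x \<delta>))" by (simp add: convex_cone_hull)
  have k: "cone (cone hull (ball x \<delta>))" by (simp add: cone_cone_hull)
  have "0 \<in> cone hull (ball x \<delta>)"
    unfolding mem_cone_hull_ball using assms by (intro exI[of _ 0] exI[of _ x]) auto
  then show ?thesis using c k convex_cone[of "cone hull (ball x \<delta>)"]
    unfolding convex_cone_iff by blast
qed

text \<open>The direction \<open>x\<close> is interior to the cone, so any vector is pushed into the cone by adding a large
enough multiple of \<open>x\<close>.\<close>

lemma cone_hull_ball_absorbs:
  fixes x :: "'a::real_normed_vector"
  assumes d: "\<delta> > 0"
  shows "\<exists>T\<ge>0. T *\<^sub>R x + p \<in> cone hull (ball x \<delta>)"
proof -
  define T where "T = (norm p + 1) / \<delta>"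
  have T: "T > 0" using d by (auto simp: T_def intro!: divide_pos_pos add_nonneg_pos)
  have "norm p / T < \<delta>" using d T by (simp add: T_def field_simps)
  then have "x + p /\<^sub>R T \<in> ball x \<delta>"
    using T by (simp add: dist_norm divide_inverse mult.commute)
  moreover have "T *\<^sub>R x + p = T *\<^sub>R (x + p /\<^sub>R T)" using T by (simp add: algebra_simps)
  ultimately have "T *\<^sub>R x + p \<in> cone hull (ball x \<delta>)"
    unfolding mem_cone_hull_ball using T by (metis less_imp_le)
  then show ?thesis using T by (metis less_imp_le)
qed

text \<open>A Cauchy-type argument that turns additivity across two cones into additivity within one: for
\<open>q\<close> far out in the second cone, \<open>p' + q\<close> still lies in that cone, so \<open>e(p + p' + q)\<close> can be expanded
both as \<open>e(p + p') + e(q)\<close> and as \<open>e(p) + e(p' + q) = e(p) + e(p') + e(q)\<close>.\<close>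

lemma additive_between_cones:
  fixes e :: "'a::real_normed_vector \<Rightarrow> real"
  assumes d: "\<delta> > 0"
    and add: "\<And>p q. p \<in> cone hull (ball x \<delta>) \<Longrightarrow> q \<in> cone hull (ball y \<delta>) \<Longrightarrow> e (p + q) = e p + e q"
    and p: "p \<in> cone hull (ball x \<delta>)" "p' \<in> cone hull (ball x \<delta>)"
  shows "e (p + p') = e p + e p'"
proof -
  obtain T where T: "T \<ge> 0" "T *\<^sub>R y + p' \<in> cone hull (ball y \<delta>)"
    using cone_hull_ball_absorbs[OF d] by blast
  have Ty: "T *\<^sub>R y \<in> cone hull (ball y \<delta>)"
    unfolding mem_cone_hull_ball using T d by (metis centre_in_ball)
  have pp: "p + p' \<in> cone hull (ball x \<delta>)"
    using convex_cone_add[OF convex_cone_cone_hull_ball[OF d] p] .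
  have "e ((p + p') + T *\<^sub>R y) = e (p + p') + e (T *\<^sub>R y)" by (rule add[OF pp Ty])
  moreover have "e (p + (T *\<^sub>R y + p')) = e p + e (T *\<^sub>R y + p')" by (rule add[OF p(1) T(2)])
  moreover have "e (p' + T *\<^sub>R y) = e p' + e (T *\<^sub>R y)" by (rule add[OF p(2) Ty])
  ultimately show ?thesis by (simp add: algebra_simps)
qed

text \<open>Failure of additivity of \<open>d\<close> is an open condition on the pair of vectors, so \<open>e\<close> is linear on every
plane spanned by a vector near \<open>x\<close> and a vector near \<open>y\<close>. By homogeneity \<open>e\<close> is then additive
across the two open cones generated by neighbourhoods of \<open>x\<close> and \<open>y\<close>, hence additive on the
sum of the two cones, and that sum contains neighbourhoods of \<open>x\<close>, \<open>y\<close> and \<open>x + y\<close>.\<close>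

lemma functional_near_nonlinearity:
  fixes d e :: "'a::euclidean_space \<Rightarrow> real"
  assumes cont: "continuous_on UNIV d"
    and hom: "\<And>c x. e (c *\<^sub>R x) = c * e x"
    and dich: "\<And>u v. functional_on (span {u, v}) d \<or> functional_on (span {u, v}) e"
    and D: "d (x + y) \<noteq> d x + d y"
  shows "\<exists>z \<delta>. \<delta> > 0 \<and> (\<forall>a\<in>{x, y, x + y}. \<forall>b\<in>ball a \<delta>. e b = z \<bullet> b)"
proof -
  define f where "f = (\<lambda>p::'a \<times> 'a. d (fst p + snd p) - d (fst p) - d (snd p))"
  have cf: "continuous_on UNIV f" unfolding f_def
    by (intro continuous_intros continuous_on_compose2[OF cont]) auto
  have "open (f -` (- {0}))" using cf by (intro open_vimage) auto
  moreover have "(x, y) \<in> f -` (- {0})" using D by (simp add: f_def)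
  ultimately obtain A B where AB: "open A" "open B" "(x, y) \<in> A \<times> B" "A \<times> B \<subseteq> f -` (- {0})"
    by (metis open_prod_elim)
  obtain \<delta>1 where d1: "\<delta>1 > 0" "ball x \<delta>1 \<subseteq> A" using AB open_contains_ball by blast
  obtain \<delta>2 where d2: "\<delta>2 > 0" "ball y \<delta>2 \<subseteq> B" using AB open_contains_ball by blast
  define \<delta> where "\<delta> = min \<delta>1 \<delta>2"
  have \<delta>: "\<delta> > 0" using d1 d2 by (simp add: \<delta>_def)
  have Dne: "d (p + q) \<noteq> d p + d q" if "p \<in> ball x \<delta>" "q \<in> ball y \<delta>" for p q
  proof -
    have "p \<in> ball x \<delta>1" "q \<in> ball y \<delta>2" using that by (auto simp: \<delta>_def)
    then have "(p, q) \<in> A \<times> B" using d1 d2 by blast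
    then show ?thesis using AB(4) by (auto simp: f_def)
  qed
  let ?X = "cone hull (ball x \<delta>)" and ?Y = "cone hull (ball y \<delta>)"
  have addXY: "e (p + q) = e p + e q" if pq: "p \<in> ?X" "q \<in> ?Y" for p q
  proof -
    obtain s p' where p: "p' \<in> ball x \<delta>" "p = s *\<^sub>R p'" using pq unfolding mem_cone_hull_ball by blast
    obtain t q' where q: "q' \<in> ball y \<delta>" "q = t *\<^sub>R q'" using pq unfolding mem_cone_hull_ball by blast
    have "\<not> functional_on (span {p', q'}) d"
      using functional_on_span_pairD[of p' q' d 1 1] Dne[OF p(1) q(1)] by auto
    then have "functional_on (span {p', q'}) e" using dich by blast
    from functional_on_span_pairD[OF this] show ?thesis using p q hom by simp
  qed
  have addX: "e (p + p') = e p + e p'" if "p \<in> ?X" "p' \<in> ?X" for p p'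
    using additive_between_cones[OF \<delta> addXY that] by blast
  have addY: "e (q + q') = e q + e q'" if "q \<in> ?Y" "q' \<in> ?Y" for q q'
    by (rule additive_between_cones[OF \<delta> _ that, of x]) (metis addXY add.commute)
  have ccX: "convex_cone ?X" and ccY: "convex_cone ?Y"
    using convex_cone_cone_hull_ball[OF \<delta>] by auto
  let ?C = "\<Union>p\<in>?X. \<Union>q\<in>?Y. {p + q}"
  have ccC: "convex_cone ?C" by (rule convex_cone_sums[OF ccX ccY])
  have "functional_on ?C e"
  proof (rule additive_on_convex_cone_functional[OF ccC])
    fix u v assume "u \<in> ?C" "v \<in> ?C"
    then obtain p q p' q' where *: "p \<in> ?X" "q \<in> ?Y" "p' \<in> ?X" "q' \<in> ?Y" "u = p + q" "v = p' + q'"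
      by blast
    have "e (u + v) = e ((p + p') + (q + q'))" using * by (simp add: algebra_simps)
    also have "\<dots> = e (p + p') + e (q + q')"
      using * by (intro addXY convex_cone_add ccX ccY)
    finally show "e (u + v) = e u + e v" using * addX addY addXY by simp
  qed (use hom in auto)
  then obtain z where z: "\<forall>w\<in>?C. e w = z \<bullet> w" unfolding functional_on_def by blast
  have bX: "ball x \<delta> \<subseteq> ?X" and bY: "ball y \<delta> \<subseteq> ?Y" by (simp_all add: hull_subset)
  have sub: "b \<in> ?C" if a: "a \<in> {x, y, x + y}" and b: "b \<in> ball a \<delta>" for a b
  proof -
    have 0: "0 \<in> ?X" "0 \<in> ?Y" using ccX ccY convex_cone_contains_0 by auto
    have y: "y \<in> ?Y" using bY \<delta> by auto
    consider "a = x" | "a = y" | "a = x + y" using a by blast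
    then show ?thesis
    proof cases
      case 1 then have "b \<in> ?X" "b = b + 0" using b bX by auto
      then show ?thesis using 0 by blast
    next
      case 2 then have "b \<in> ?Y" "b = 0 + b" using b bY by auto
      then show ?thesis using 0 by blast
    next
      case 3 then have "b - y \<in> ball x \<delta>" using b by (simp add: dist_norm algebra_simps)
      then have "b - y \<in> ?X" "b = (b - y) + y" using bX by auto
      then show ?thesis using y by blast
    qed
  qed
  have "\<forall>a\<in>{x, y, x + y}. \<forall>b\<in>ball a \<delta>. e b = z \<bullet> b"
    by (intro ballI bspec[OF z] sub)
  then show ?thesis using \<delta> by blast
qed

text \<open>Two linear functions on the span of \<open>a\<close> and \<open>b\<close> that agree near \<open>a\<close> agree at \<open>a\<close> and at
\<open>a + t b\<close> for small \<open>t > 0\<close>, hence at \<open>b\<close>.\<close>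

lemma functional_on_span_agrees:
  fixes e :: "'a::real_inner \<Rightarrow> real"
  assumes f: "functional_on (span {a, b}) e" and "\<delta> > 0" and near: "\<forall>c\<in>ball a \<delta>. e c = z \<bullet> c"
  shows "e b = z \<bullet> b"
proof -
  define t where "t = \<delta> / (2 * (norm b + 1))"
  have np: "norm b + 1 > 0" by (simp add: add_nonneg_pos)
  have t: "t > 0" using assms np by (simp add: t_def)
  have "t * norm b < t * (2 * (norm b + 1))"
    using t norm_ge_zero[of b] by (simp add: mult_strict_left_mono del: norm_ge_zero)
  then have "t * norm b < \<delta>" using np by (simp add: t_def)
  then have "a + t *\<^sub>R b \<in> ball a \<delta>" using t by (simp add: dist_norm)
  then have "e (a + t *\<^sub>R b) = z \<bullet> (a + t *\<^sub>R b)" "e a = z \<bullet> a" using near \<open>\<delta> > 0\<close> by auto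
  moreover have "e (a + t *\<^sub>R b) = e a + t * e b"
    using functional_on_span_pairD[OF f, of 1 t] by simp
  ultimately have "t * e b = t * (z \<bullet> b)" by (simp add: inner_add_right)
  then show ?thesis using t by simp
qed

text \<open>The neighbourhoods supplied by \<open>functional_near_nonlinearity\<close> for the two failures of additivity
contradict the hypothesis on a single well-chosen plane, one that passes through both
neighbourhoods; the planes where additivity fails need not meet outside the origin.\<close>

lemma functional_dichotomy:
  fixes d e :: "'a::euclidean_space \<Rightarrow> real"
  assumes cont: "continuous_on UNIV d" "continuous_on UNIV e"
    and hom: "\<And>c x. d (c *\<^sub>R x) = c * d x" "\<And>c x. e (c *\<^sub>R x) = c * e x"
    and dich: "\<And>u v. functional_on (span {u, v}) d \<or> functional_on (span {u, v}) e"
  shows "functional_on UNIV d \<or> functional_on UNIV e"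
proof (rule ccontr)
  assume "\<not> ?thesis"
  then obtain x y x' y' where D: "d (x + y) \<noteq> d x + d y" and E: "e (x' + y') \<noteq> e x' + e y'"
    using linear_functional_on_UNIV[of d] linear_functional_on_UNIV[of e] hom by blast
  obtain z \<delta> where z: "\<delta> > 0" "\<forall>a\<in>{x, y, x + y}. \<forall>b\<in>ball a \<delta>. e b = z \<bullet> b"
    using functional_near_nonlinearity[OF cont(1) hom(2) dich D] by blast
  obtain z' \<delta>' where z': "\<delta>' > 0" "\<forall>a\<in>{x', y', x' + y'}. \<forall>b\<in>ball a \<delta>'. d b = z' \<bullet> b"
    using functional_near_nonlinearity[OF cont(2) hom(1) _ E] dich by blast
  \<comment> \<open>A linear functional cannot agree with \<open>d\<close> at all three points, as \<open>d\<close> is not additive there.\<close>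
  obtain a where a: "a \<in> {x, y, x + y}" "d a \<noteq> z' \<bullet> a"
    using D by (metis inner_add_right insert_iff)
  obtain b where b: "b \<in> {x', y', x' + y'}" "e b \<noteq> z \<bullet> b"
    using E by (metis inner_add_right insert_iff)
  have "\<not> functional_on (span {a, b}) e"
    using functional_on_span_agrees[of a b e \<delta> z] z a b by blast
  moreover have "\<not> functional_on (span {b, a}) d"
    using functional_on_span_agrees[of b a d \<delta>' z'] z' a b by blast
  ultimately show False using dich[of a b] by (simp add: insert_commute)
qed

section \<open>Homothety of finite sublinear functions\<close>

definition sublinear_on :: "'a::real_vector set \<Rightarrow> ('a \<Rightarrow> real) \<Rightarrow> bool" where
  "sublinear_on B h \<longleftrightarrow> convex_cone B \<and> (\<forall>x\<in>B. \<forall>y\<in>B. h (x + y) \<le> h x + h y) \<and>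
     (\<forall>x\<in>B. \<forall>c\<ge>0. h (c *\<^sub>R x) = c * h x)"

lemma sublinear_onD:
  assumes "sublinear_on B h"
  shows "convex_cone B" "x \<in> B \<Longrightarrow> y \<in> B \<Longrightarrow> h (x + y) \<le> h x + h y"
    "x \<in> B \<Longrightarrow> c \<ge> 0 \<Longrightarrow> h (c *\<^sub>R x) = c * h x" "h 0 = 0"
proof -
  show "convex_cone B" "x \<in> B \<Longrightarrow> y \<in> B \<Longrightarrow> h (x + y) \<le> h x + h y"
    "x \<in> B \<Longrightarrow> c \<ge> 0 \<Longrightarrow> h (c *\<^sub>R x) = c * h x"
    using assms unfolding sublinear_on_def by auto
  show "h 0 = 0"
    using assms convex_cone_contains_0[of B] unfolding sublinear_on_def
    by (metis mult_zero_left order_refl scale_zero_left)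
qed

lemma subspace_imp_convex_cone: "subspace W \<Longrightarrow> convex_cone W"
  by (auto simp: convex_cone_iff subspace_add subspace_scale subspace_0)

text \<open>Zero width makes \<open>h\<close> odd, and subadditivity of an odd function applied to \<open>(x + y) + (-y)\<close> gives the
reverse inequality.\<close>

lemma functional_on_zero_width:
  fixes h :: "'a::euclidean_space \<Rightarrow> real"
  assumes W: "subspace W" "W \<subseteq> B" and h: "sublinear_on B h"
    and w: "\<And>x. x \<in> W \<Longrightarrow> h x + h (- x) = 0"
  shows "functional_on W h"
proof (rule additive_on_convex_cone_functional)
  show "convex_cone W" using W(1) by (rule subspace_imp_convex_cone)
  show "h (c *\<^sub>R x) = c * h x" if "x \<in> W" "c \<ge> 0" for c x
    using sublinear_onD(3)[OF h] that W by blast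
  show "h (x + y) = h x + h y" if x: "x \<in> W" and y: "y \<in> W" for x y
  proof -
    have xy: "x + y \<in> W" "- y \<in> W" using W x y by (auto simp: subspace_add subspace_neg)
    have "h ((x + y) + - y) \<le> h (x + y) + h (- y)"
      using sublinear_onD(2)[OF h] xy W by blast
    moreover have "h (x + y) \<le> h x + h y" using sublinear_onD(2)[OF h] x y W by blast
    ultimately show ?thesis using w[OF y] by simp
  qed
qed

lemma sublinear_continuous:
  fixes h :: "'a::euclidean_space \<Rightarrow> real"
  assumes h: "sublinear_on UNIV h"
  shows "continuous_on UNIV h"
proof (rule convex_on_continuous)
  show "convex_on UNIV h"
  proof (rule convex_onI)
    fix t :: real and x y :: 'a
    assume "0 < t" "t < 1"
    have "h ((1 - t) *\<^sub>R x + t *\<^sub>R y) \<le> h ((1 - t) *\<^sub>R x) + h (t *\<^sub>R y)"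
      using sublinear_onD(2)[OF h] by blast
    then show "h ((1 - t) *\<^sub>R x + t *\<^sub>R y) \<le> (1 - t) * h x + t * h y"
      using sublinear_onD(3)[OF h] \<open>0 < t\<close> \<open>t < 1\<close> by simp
  qed simp
qed simp

lemma homogeneous_if_odd:
  fixes f :: "'a::real_vector \<Rightarrow> real"
  assumes pos: "\<And>c x. c \<ge> 0 \<Longrightarrow> f (c *\<^sub>R x) = c * f x" and odd: "\<And>x. f (- x) = - f x"
  shows "f (c *\<^sub>R x) = c * f x"
  using pos[of c x] pos[of "- c" x] odd[of "c *\<^sub>R x"] by (cases "c \<ge> 0") auto

text \<open>The widths fix \<open>\<bar>c\<bar> = \<mu>\<close>, and the dichotomy decides between \<open>c = \<mu>\<close> and \<open>c = -\<mu>\<close>. On a span where the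
width of \<open>h2\<close> vanishes, \<open>c\<close> is undetermined; there both functions are linear, and so is \<open>d\<close>. If
the width vanishes everywhere (both sets are points), any ratio works.\<close>

lemma sublinear_homothetic_of_pairs:
  fixes h1 h2 :: "'a::euclidean_space \<Rightarrow> real"
  assumes h1: "sublinear_on UNIV h1" and h2: "sublinear_on UNIV h2"
    and pairs: "\<And>u v. \<exists>z c. c \<noteq> 0 \<and> (\<forall>w\<in>span {u, v}. h1 w = z \<bullet> w + h2 (c *\<^sub>R w))"
  shows "\<exists>z c. c \<noteq> 0 \<and> (\<forall>w. h1 w = z \<bullet> w + h2 (c *\<^sub>R w))"
proof -
  define w1 where "w1 = (\<lambda>u. h1 u + h1 (- u))"
  define w2 where "w2 = (\<lambda>u. h2 u + h2 (- u))"
  have pos: "h1 (c *\<^sub>R x) = c * h1 x" "h2 (c *\<^sub>R x) = c * h2 x" if "c \<ge> 0" for c x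
    using sublinear_onD(3)[OF h1] sublinear_onD(3)[OF h2] that by auto
  have abs2: "w2 (c *\<^sub>R x) = \<bar>c\<bar> * w2 x" for c x
    using pos(2)[of c x] pos(2)[of "- c" x] pos(2)[of c "- x"] pos(2)[of "- c" "- x"]
    by (cases "c \<ge> 0") (auto simp: w2_def algebra_simps)
  have width: "w1 w = \<bar>c\<bar> * w2 w"
    if "\<forall>w\<in>span {u, v}. h1 w = z \<bullet> w + h2 (c *\<^sub>R w)" "w \<in> span {u, v}" for u v w z c
  proof -
    have "- w \<in> span {u, v}" using that(2) by (rule span_neg)
    then have "h1 w = z \<bullet> w + h2 (c *\<^sub>R w)" "h1 (- w) = z \<bullet> (- w) + h2 (c *\<^sub>R (- w))"
      using that by blast+
    then show ?thesis by (simp add: w1_def abs2[symmetric]) (simp add: w2_def)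
  qed
  show ?thesis
  proof (cases "\<forall>u. w2 u = 0")
    case True
    have "w1 u = 0" for u
    proof -
      obtain z c where "\<forall>w\<in>span {u, u}. h1 w = z \<bullet> w + h2 (c *\<^sub>R w)" using pairs by blast
      from width[OF this, of u] show ?thesis using True by (simp add: span_base)
    qed
    then have "functional_on UNIV h1" "functional_on UNIV h2"
      using functional_on_zero_width[of UNIV UNIV] h1 h2 True by (auto simp: w1_def w2_def)
    then obtain z1 z2 where "\<forall>w. h1 w = z1 \<bullet> w" "\<forall>w. h2 w = z2 \<bullet> w"
      unfolding functional_on_def by auto
    then have "\<forall>w. h1 w = (z1 - z2) \<bullet> w + h2 (1 *\<^sub>R w)" by (simp add: inner_diff_left)
    then show ?thesis by (metis zero_neq_one)
  next
    case False
    then obtain u0 where u0: "w2 u0 \<noteq> 0" by blast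
    define \<mu> where "\<mu> = w1 u0 / w2 u0"
    have w12: "w1 u = \<mu> * w2 u \<and> \<mu> > 0" for u
    proof -
      obtain z c where c: "c \<noteq> 0" "\<forall>w\<in>span {u, u0}. h1 w = z \<bullet> w + h2 (c *\<^sub>R w)"
        using pairs by blast
      have "w1 u0 = \<bar>c\<bar> * w2 u0" "w1 u = \<bar>c\<bar> * w2 u"
        by (rule width[OF c(2)]; simp add: span_base)+
      then show ?thesis using u0 c(1) by (simp add: \<mu>_def)
    qed
    then have \<mu>: "\<mu> > 0" by blast
    define d where "d = (\<lambda>u. h1 u - h2 (\<mu> *\<^sub>R u))"
    define e where "e = (\<lambda>u. h1 u - h2 ((- \<mu>) *\<^sub>R u))"
    have hom: "d (c *\<^sub>R x) = c * d x" "e (c *\<^sub>R x) = c * e x" for c x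
    proof -
      have odd: "d (- x) = - d x \<and> e (- x) = - e x" for x
        using w12[of x] abs2[of \<mu> x] \<mu> by (auto simp: d_def e_def w1_def w2_def)
      have "d (c *\<^sub>R x) = c * d x \<and> e (c *\<^sub>R x) = c * e x" if "c \<ge> 0" for c x
      proof -
        have "h2 (c *\<^sub>R (\<mu> *\<^sub>R x)) = c * h2 (\<mu> *\<^sub>R x)" 
          "h2 (c *\<^sub>R ((- \<mu>) *\<^sub>R x)) = c * h2 ((- \<mu>) *\<^sub>R x)"
          using pos(2)[OF that] by blast+
        then show ?thesis using pos(1)[OF that]
          by (simp add: d_def e_def algebra_simps)
      qed
      then show "d (c *\<^sub>R x) = c * d x" "e (c *\<^sub>R x) = c * e x"
        using homogeneous_if_odd[of d] homogeneous_if_odd[of e] odd by blast+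
    qed
    have cont: "continuous_on UNIV d" "continuous_on UNIV e" unfolding d_def e_def
      by (intro continuous_intros sublinear_continuous[OF h1]
          continuous_on_compose2[OF sublinear_continuous[OF h2]]; simp)+
    have dich: "functional_on (span {u, v}) d \<or> functional_on (span {u, v}) e" for u v
    proof -
      obtain z c where c: "c \<noteq> 0" "\<forall>w\<in>span {u, v}. h1 w = z \<bullet> w + h2 (c *\<^sub>R w)"
        using pairs by blast
      show ?thesis
      proof (cases "\<forall>w\<in>span {u, v}. w2 w = 0")
        case True
        have "functional_on (span {u, v}) h2"
          using functional_on_zero_width[OF subspace_span _ h2] True by (simp add: w2_def)
        then obtain q where q: "\<forall>w\<in>span {u, v}. h2 w = q \<bullet> w"
          unfolding functional_on_def by blast
        have "\<forall>w\<in>span {u, v}. d w = (z + (c - \<mu>) *\<^sub>R q) \<bullet> w"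
          using c(2) q by (simp add: d_def span_scale inner_add_left algebra_simps)
        then show ?thesis unfolding functional_on_def by blast
      next
        case False
        then obtain w where w: "w \<in> span {u, v}" "w2 w \<noteq> 0" by blast
        then have "\<bar>c\<bar> = \<mu>" using width[OF c(2) w(1)] w12[of w] by simp
        then consider "c = \<mu>" | "c = - \<mu>" by linarith
        then show ?thesis
        proof cases
          case 1 then have "\<forall>w\<in>span {u, v}. d w = z \<bullet> w" using c(2) by (simp add: d_def)
          then show ?thesis unfolding functional_on_def by blast
        next
          case 2 then have "\<forall>w\<in>span {u, v}. e w = z \<bullet> w" using c(2) by (simp add: e_def)
          then show ?thesis unfolding functional_on_def by blast
        qed
      qed
    qed
    from functional_dichotomy[OF cont hom dich] show ?thesis
    proof
      assume "functional_on UNIV d"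
      then obtain z where "\<forall>w. d w = z \<bullet> w" unfolding functional_on_def by blast
      then have "\<forall>w. h1 w = z \<bullet> w + h2 (\<mu> *\<^sub>R w)" by (simp add: d_def algebra_simps)
      then show ?thesis using \<mu> by (metis less_irrefl)
    next
      assume "functional_on UNIV e"
      then obtain z where "\<forall>w. e w = z \<bullet> w" unfolding functional_on_def by blast
      then have "\<forall>w. h1 w = z \<bullet> w + h2 ((- \<mu>) *\<^sub>R w)" by (simp add: e_def algebra_simps)
      then show ?thesis using \<mu> by (metis less_irrefl neg_equal_0_iff_equal)
    qed
  qed
qed

section \<open>Homothety of sublinear functions on a cone that is not a subspace\<close>

definition deficit :: "('a::ab_group_add \<Rightarrow> real) \<Rightarrow> 'a \<Rightarrow> 'a \<Rightarrow> real" where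
  "deficit h u v = h u + h v - h (u + v)"

text \<open>Both sides equal \<open>h u + h v + h w - h (u + v + w)\<close>. Together with nonnegativity of deficits this
lets a nonzero deficit be transported from one pair of vectors to another.\<close>

lemma deficit_cocycle:
  "deficit h u (v + w) + deficit h v w = deficit h u v + deficit h (u + v) w"
  by (simp add: deficit_def algebra_simps)

text \<open>Passing to the deficit removes the linear part \<open>z\<close>, so the ratio \<open>\<rho>\<close> of the two deficits is the
homothety ratio of each subspace on which it is defined. The proof shows that \<open>\<rho>\<close> does not depend
on the pair, by walking through triples. Each triple must contain a \<open>directed\<close> vector,
that is, one whose negative lies outside \<open>B\<close>, because such a vector excludes a negative ratio.\<close>

lemma sublinear_homothetic_of_triples:
  fixes h1 h2 :: "'a::euclidean_space \<Rightarrow> real"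
  assumes h1: "sublinear_on B h1" and h2: "sublinear_on B h2"
    and x0: "x0 \<in> B" "- x0 \<notin> B"
    and triples: "\<And>u v w. \<exists>z c. c \<noteq> 0 \<and> (\<forall>y\<in>span {u, v, w} \<inter> B.
       c *\<^sub>R y \<in> B \<and> h1 y = z \<bullet> y + h2 (c *\<^sub>R y))"
  shows "\<exists>z c. c > 0 \<and> (\<forall>y\<in>B. h1 y = z \<bullet> y + h2 (c *\<^sub>R y))"
proof -
  note cone = sublinear_onD(1)[OF h1]
  note addB = convex_cone_add[OF cone]
  note posB = convex_cone_scaleR[OF cone]
  define H1 where "H1 = deficit h1"
  define H2 where "H2 = deficit h2"
  have H2_nonneg: "H2 a b \<ge> 0" if "a \<in> B" "b \<in> B" for a b
    using sublinear_onD(2)[OF h2 that] by (simp add: H2_def deficit_def)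
  define directed where "directed = (\<lambda>p. p \<in> B \<and> - p \<notin> B)"
  have ratio: "\<exists>c>0. \<forall>a\<in>span {u, v, w} \<inter> B. \<forall>b\<in>span {u, v, w} \<inter> B. H1 a b = c * H2 a b"
    if p: "directed u" for u v w
  proof -
    obtain z c where c: "c \<noteq> 0"
      and rel: "\<And>y. y \<in> span {u, v, w} \<inter> B \<Longrightarrow> c *\<^sub>R y \<in> B \<and> h1 y = z \<bullet> y + h2 (c *\<^sub>R y)"
      using triples by blast
    have "c > 0"
    proof (rule ccontr)
      assume "\<not> c > 0"
      then have "c < 0" using c by simp
      have "c *\<^sub>R u \<in> B" using rel[of u] p by (simp add: directed_def span_base)
      moreover have "(1 / - c) *\<^sub>R (c *\<^sub>R u) = - u" using \<open>c < 0\<close> by simp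
      ultimately have "- u \<in> B" using posB[of "1 / - c" "c *\<^sub>R u"] \<open>c < 0\<close> by simp
      then show False using p \<open>c < 0\<close> by (simp add: directed_def)
    qed
    have "h1 y = z \<bullet> y + c * h2 y" if "y \<in> span {u, v, w} \<inter> B" for y
      using rel[OF that] sublinear_onD(3)[OF h2, of y c] that \<open>c > 0\<close> by simp
    then have "H1 a b = c * H2 a b"
      if "a \<in> span {u, v, w} \<inter> B" "b \<in> span {u, v, w} \<inter> B" for a b
      using that addB span_add[of a "{u, v, w}" b]
      by (simp add: H1_def H2_def deficit_def inner_add_right algebra_simps)
    then show ?thesis using \<open>c > 0\<close> by blast
  qed
  define \<rho> where "\<rho> = (\<lambda>a b. H1 a b / H2 a b)"
  have step: "\<rho> a b = \<rho> a' b'"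
    if du: "directed u" and sub: "{a, b, a', b'} \<subseteq> span {u, v, w} \<inter> B"
      and ne: "H2 a b \<noteq> 0" "H2 a' b' \<noteq> 0" for u v w a b a' b'
  proof -
    obtain c where "\<forall>a\<in>span {u, v, w} \<inter> B. \<forall>b\<in>span {u, v, w} \<inter> B. H1 a b = c * H2 a b"
      using ratio[OF du] by blast
    then have "H1 a b = c * H2 a b" "H1 a' b' = c * H2 a' b'" using sub by auto
    then show ?thesis using ne by (simp add: \<rho>_def)
  qed
  have chain: "\<rho> u v = \<rho> u' v'"
    if du: "directed u" "directed u'" and B: "v \<in> B" "v' \<in> B"
      and ne: "H2 u v \<noteq> 0" "H2 u' v' \<noteq> 0" for u v u' v'
  proof -
    have uB: "u \<in> B" "u' \<in> B" using du by (auto simp: directed_def)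
    consider "H2 u u' \<noteq> 0" | "H2 u v' \<noteq> 0" | "H2 v u' \<noteq> 0" | "H2 v v' \<noteq> 0"
      | "H2 u u' = 0" "H2 u v' = 0" "H2 v u' = 0" "H2 v v' = 0" by blast
    then show ?thesis
    proof cases
      case 1
      have "\<rho> u v = \<rho> u u'" by (rule step[OF du(1), of _ _ _ _ v u']) (use ne 1 uB B in \<open>auto intro: span_base span_add\<close>)
      also have "\<dots> = \<rho> u' v'" by (rule step[OF du(1), of _ _ _ _ u' v']) (use ne 1 uB B in \<open>auto intro: span_base span_add\<close>)
      finally show ?thesis .
    next
      case 2
      have "\<rho> u v = \<rho> u v'" by (rule step[OF du(1), of _ _ _ _ v v']) (use ne 2 uB B in \<open>auto intro: span_base span_add\<close>)
      also have "\<dots> = \<rho> u' v'" by (rule step[OF du(1), of _ _ _ _ u' v']) (use ne 2 uB B in \<open>auto intro: span_base span_add\<close>)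
      finally show ?thesis .
    next
      case 3
      have "\<rho> u v = \<rho> v u'" by (rule step[OF du(1), of _ _ _ _ v u']) (use ne 3 uB B in \<open>auto intro: span_base span_add\<close>)
      also have "\<dots> = \<rho> u' v'" by (rule step[OF du(2), of _ _ _ _ v v']) (use ne 3 uB B in \<open>auto intro: span_base span_add\<close>)
      finally show ?thesis .
    next
      case 4
      have "\<rho> u v = \<rho> v v'" by (rule step[OF du(1), of _ _ _ _ v v']) (use ne 4 uB B in \<open>auto intro: span_base span_add\<close>)
      also have "\<dots> = \<rho> u' v'" by (rule step[OF du(2), of _ _ _ _ v v']) (use ne 4 uB B in \<open>auto intro: span_base span_add\<close>)
      finally show ?thesis .
    next
      case 5
      \<comment> \<open>No deficit links the two pairs. Then \<open>v + u'\<close> serves as an intermediate vector: by the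
        cocycle identity its deficits with \<open>u\<close> and with \<open>v'\<close> are at least those of the original pairs.\<close>
      have pos: "H2 u v > 0" "H2 u' v' > 0"
        using ne H2_nonneg uB B by (metis order_le_less)+
      have "H2 u (v + u') + H2 v u' = H2 u v + H2 (u + v) u'"
        "H2 v (u' + v') + H2 u' v' = H2 v u' + H2 (v + u') v'"
        unfolding H2_def by (rule deficit_cocycle)+
      moreover have "H2 (u + v) u' \<ge> 0" "H2 v (u' + v') \<ge> 0"
        using H2_nonneg uB B addB by auto
      ultimately have ne': "H2 u (v + u') \<noteq> 0" "H2 (v + u') v' \<noteq> 0" using pos 5 by linarith+
      have vu: "v + u' \<in> B" using addB uB B by blast
      have "\<rho> u v = \<rho> u (v + u')"
        by (rule step[OF du(1), of _ _ _ _ v u']) (use ne ne' uB B vu in \<open>auto intro: span_base span_add\<close>)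
      also have "\<dots> = \<rho> (v + u') v'"
        by (rule step[OF du(1), of _ _ _ _ "v + u'" v']) (use ne ne' uB B vu in \<open>auto intro: span_base span_add\<close>)
      also have "\<dots> = \<rho> u' v'"
        by (rule step[OF du(2), of _ _ _ _ v v']) (use ne ne' uB B vu in \<open>auto intro: span_base span_add\<close>)
      finally show ?thesis .
    qed
  qed
  have dx0: "directed x0" using x0 by (simp add: directed_def)
  \<comment> \<open>Adding the directed vector \<open>x0\<close> to \<open>u\<close> gives a directed vector, and by the cocycle identity
    \<open>(x0, u)\<close> or \<open>(x0 + u, v)\<close> has positive deficit as soon as \<open>(u, v)\<close> has.\<close>
  have directedize: "\<exists>p q. directed p \<and> q \<in> B \<and> H2 p q \<noteq> 0 \<and> \<rho> u v = \<rho> p q"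
    if uv: "u \<in> B" "v \<in> B" and ne: "H2 u v \<noteq> 0" for u v
  proof -
    have pos: "H2 u v > 0" using ne H2_nonneg[OF uv] by linarith
    have xu: "x0 + u \<in> B" "directed (x0 + u)"
    proof -
      show *: "x0 + u \<in> B" using addB x0 uv by blast
      have "- (x0 + u) \<notin> B"
      proof
        assume "- (x0 + u) \<in> B"
        then have "- (x0 + u) + u \<in> B" using addB uv by blast
        then show False using x0 by simp
      qed
      then show "directed (x0 + u)" using * by (simp add: directed_def)
    qed
    have "H2 x0 (u + v) + H2 u v = H2 x0 u + H2 (x0 + u) v"
      unfolding H2_def by (rule deficit_cocycle)
    moreover have "H2 x0 (u + v) \<ge> 0" using H2_nonneg x0 uv addB by auto
    ultimately consider "H2 x0 u \<noteq> 0" | "H2 (x0 + u) v \<noteq> 0" using pos by linarith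
    then show ?thesis
    proof cases
      case 1
      have "\<rho> u v = \<rho> x0 u"
        by (rule step[OF dx0, of _ _ _ _ u v]) (use 1 x0 ne uv in \<open>auto intro: span_base span_add\<close>)
      then show ?thesis using dx0 uv 1 by blast
    next
      case 2
      have "\<rho> u v = \<rho> (x0 + u) v"
        by (rule step[OF dx0, of _ _ _ _ u v]) (use 2 x0 xu ne uv in \<open>auto intro: span_base span_add\<close>)
      then show ?thesis using xu uv 2 by blast
    qed
  qed
  have ratio_pair: "\<exists>c>0. H1 u v = c * H2 u v" if "u \<in> B" "v \<in> B" for u v
  proof -
    obtain c where "c > 0" "\<forall>a\<in>span {x0, u, v} \<inter> B. \<forall>b\<in>span {x0, u, v} \<inter> B. H1 a b = c * H2 a b"
      using ratio[OF dx0] by blast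
    then show ?thesis using that by (auto intro: span_base)
  qed
  obtain c where c: "c > 0" "\<And>u v. u \<in> B \<Longrightarrow> v \<in> B \<Longrightarrow> H1 u v = c * H2 u v"
  proof (cases "\<exists>p\<in>B. \<exists>q\<in>B. H2 p q \<noteq> 0")
    case True
    then obtain p q where pq: "p \<in> B" "q \<in> B" "H2 p q \<noteq> 0" by blast
    have "\<rho> p q > 0" using ratio_pair[OF pq(1,2)] pq(3) by (auto simp: \<rho>_def)
    moreover have "H1 u v = \<rho> p q * H2 u v" if uv: "u \<in> B" "v \<in> B" for u v
    proof (cases "H2 u v = 0")
      case True then show ?thesis using ratio_pair[OF uv] by auto
    next
      case False
      then have "\<rho> u v = \<rho> p q" using directedize uv pq chain by metis
      then show ?thesis using False unfolding \<rho>_def by (metis nonzero_eq_divide_eq)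
    qed
    ultimately show ?thesis using that by blast
  next
    case False
    \<comment> \<open>Both functions are additive on \<open>B\<close>, so every positive ratio would do.\<close>
    have "H1 u v = 1 * H2 u v" if "u \<in> B" "v \<in> B" for u v
      using ratio_pair[OF that] False that by fastforce
    then show ?thesis using that[of 1] by simp
  qed
  have "functional_on B (\<lambda>y. h1 y - c * h2 y)"
  proof (rule additive_on_convex_cone_functional[OF cone])
    show "h1 (x + y) - c * h2 (x + y) = h1 x - c * h2 x + (h1 y - c * h2 y)"
      if "x \<in> B" "y \<in> B" for x y
      using c(2)[OF that] by (simp add: H1_def H2_def deficit_def algebra_simps)
    show "h1 (t *\<^sub>R x) - c * h2 (t *\<^sub>R x) = t * (h1 x - c * h2 x)" if "x \<in> B" "t \<ge> 0" for t x
      using sublinear_onD(3)[OF h1 that] sublinear_onD(3)[OF h2 that] by (simp add: algebra_simps)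
  qed
  then obtain z where "\<forall>y\<in>B. h1 y - c * h2 y = z \<bullet> y" unfolding functional_on_def by blast
  then have "\<forall>y\<in>B. h1 y = z \<bullet> y + h2 (c *\<^sub>R y)"
    using sublinear_onD(3)[OF h2] c(1) by (simp add: algebra_simps)
  then show ?thesis using c(1) by blast
qed

section \<open>Orthogonal projection on a subspace\<close>

lemma orth_proj_subspace:
  fixes L :: "'a::euclidean_space set"
  assumes L: "subspace L"
  shows "orth_proj L x \<in> L" and "q \<in> L \<Longrightarrow> q \<bullet> orth_proj L x = q \<bullet> x"
    and "p \<in> L \<Longrightarrow> (\<And>q. q \<in> L \<Longrightarrow> q \<bullet> p = q \<bullet> x) \<Longrightarrow> orth_proj L x = p"
proof -
  have "plane_of_dim (int (dim L)) L"
    unfolding plane_of_dim_def using L by (intro exI[of _ 0] exI[of _ L]) auto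
  note ex1 = ex1_orth_proj[OF this, of x]
  have p: "orth_proj L x \<in> L" "\<And>q. q \<in> L \<Longrightarrow> orthogonal (x - orth_proj L x) (q - orth_proj L x)"
    using theI'[OF ex1] unfolding orth_proj_def[symmetric] by blast+
  show "orth_proj L x \<in> L" by (rule p(1))
  show "q \<bullet> orth_proj L x = q \<bullet> x" if "q \<in> L"
    using p(2)[of "orth_proj L x + q"] L p(1) that
    by (simp add: subspace_add orthogonal_def inner_diff_left inner_diff_right inner_commute)
  show "orth_proj L x = p" if p: "p \<in> L" "\<And>q. q \<in> L \<Longrightarrow> q \<bullet> p = q \<bullet> x" for p
    unfolding orth_proj_def
  proof (rule the1_equality[OF ex1], intro conjI ballI)
    fix q assume "q \<in> L"
    then have "(q - p) \<bullet> p = (q - p) \<bullet> x" using L p subspace_diff by blast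
    then show "orthogonal (x - p) (q - p)"
      by (simp add: orthogonal_def inner_commute inner_diff_right)
  qed (rule p(1))
qed

lemma linear_orth_proj:
  fixes L :: "'a::euclidean_space set"
  assumes L: "subspace L"
  shows "linear (orth_proj L)"
  by (rule linearI; rule orth_proj_subspace(3)[OF L])
    (use L orth_proj_subspace(1,2)[OF L] in
      \<open>auto simp: subspace_add subspace_scale inner_add_right\<close>)

lemma orth_proj_id:
  fixes L :: "'a::euclidean_space set"
  assumes "subspace L" "x \<in> L" shows "orth_proj L x = x"
  using orth_proj_subspace(3)[OF assms] by blast

section \<open>Homothety of sublinear functions with arbitrary domains\<close>

text \<open>The relation between the support functions of \<open>K1\<close> and \<open>K2\<close> that corresponds to
\<open>K1 = z + c K2\<close>, restricted to directions in \<open>W\<close>. A support function with values in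
\<open>\<real> \<union> {\<infinity>}\<close> is represented by its domain of finiteness \<open>B\<close> and a real function \<open>h\<close> on \<open>B\<close>.\<close>

definition homothetic_on ::
  "'a::real_inner set \<Rightarrow> 'a set \<Rightarrow> ('a \<Rightarrow> real) \<Rightarrow> 'a set \<Rightarrow> ('a \<Rightarrow> real) \<Rightarrow> bool" where
  "homothetic_on W B1 h1 B2 h2 \<longleftrightarrow> (\<exists>z c. c \<noteq> 0 \<and>
     (\<forall>u\<in>W. (u \<in> B1 \<longleftrightarrow> c *\<^sub>R u \<in> B2) \<and> (u \<in> B1 \<longrightarrow> h1 u = z \<bullet> u + h2 (c *\<^sub>R u))))"

lemma convex_cone_scaleR_iff:
  assumes "convex_cone B" "c > 0" shows "c *\<^sub>R u \<in> B \<longleftrightarrow> u \<in> B"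
  using convex_cone_scaleR[OF assms(1), of c u] assms(2)
    convex_cone_scaleR[OF assms(1), of "1 / c" "c *\<^sub>R u"] by auto

text \<open>If \<open>B\<close> is a subspace, composing with the orthogonal projection on \<open>B\<close> extends both functions to
finite sublinear functions on the whole space, and the result for those applies. Otherwise \<open>B\<close>
contains a vector whose negative is outside \<open>B\<close>, and negative ratios are excluded.\<close>

lemma homothetic_on_UNIV_same_domain:
  fixes h1 h2 :: "'a::euclidean_space \<Rightarrow> real"
  assumes h1: "sublinear_on B h1" and h2: "sublinear_on B h2"
    and triples: "\<And>u v w. homothetic_on (span {u, v, w}) B h1 B h2"
  shows "homothetic_on UNIV B h1 B h2"
proof (cases "\<forall>x\<in>B. - x \<in> B")
  case True
  note cone = sublinear_onD(1)[OF h1]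
  have B: "subspace B"
  proof (rule subspaceI)
    show "c *\<^sub>R x \<in> B" if x: "x \<in> B" for c x
      using convex_cone_scaleR[OF cone _ x, of c] convex_cone_scaleR[OF cone, of "- c" "- x"] True x
      by (cases "c \<ge> 0") auto
  qed (auto intro: convex_cone_add[OF cone] convex_cone_contains_0[OF cone])
  let ?\<pi> = "orth_proj B"
  note lin = linear_orth_proj[OF B]
  note \<pi>B = orth_proj_subspace(1)[OF B]
  have ext: "sublinear_on UNIV (\<lambda>x. h (?\<pi> x))" if "sublinear_on B h" for h
    using sublinear_onD(2,3)[OF that] \<pi>B unfolding sublinear_on_def
    by (simp add: convex_cone_iff linear_add[OF lin] linear_scale[OF lin])
  have "\<exists>z c. c \<noteq> 0 \<and> (\<forall>w\<in>span {u, v}. h1 (?\<pi> w) = z \<bullet> w + h2 (?\<pi> (c *\<^sub>R w)))" for u v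
  proof -
    obtain z c where c: "c \<noteq> 0"
      "\<And>w. w \<in> span {?\<pi> u, ?\<pi> v, ?\<pi> v} \<Longrightarrow> w \<in> B \<Longrightarrow> h1 w = z \<bullet> w + h2 (c *\<^sub>R w)"
      using triples[of "?\<pi> u" "?\<pi> v" "?\<pi> v"] unfolding homothetic_on_def by blast
    have "h1 (?\<pi> w) = ?\<pi> z \<bullet> w + h2 (?\<pi> (c *\<^sub>R w))" if w: "w \<in> span {u, v}" for w
    proof -
      have "?\<pi> w \<in> span {?\<pi> u, ?\<pi> v, ?\<pi> v}"
        using linear_span_image[OF lin, of "{u, v}"] w by auto
      then have "h1 (?\<pi> w) = z \<bullet> ?\<pi> w + h2 (c *\<^sub>R ?\<pi> w)" using c(2) \<pi>B by blast
      moreover have "z \<bullet> ?\<pi> w = ?\<pi> z \<bullet> w"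
        using orth_proj_subspace(2)[OF B, of "?\<pi> w" z] orth_proj_subspace(2)[OF B, of "?\<pi> z" w] \<pi>B
        by (simp add: inner_commute)
      ultimately show ?thesis by (simp add: linear_scale[OF lin])
    qed
    then show ?thesis using c(1) by blast
  qed
  from sublinear_homothetic_of_pairs[OF ext[OF h1] ext[OF h2] this]
  obtain z c where c: "c \<noteq> 0" "\<And>w. h1 (?\<pi> w) = z \<bullet> w + h2 (?\<pi> (c *\<^sub>R w))" by blast
  have "h1 w = z \<bullet> w + h2 (c *\<^sub>R w)" if "w \<in> B" for w
    using c(2)[of w] that orth_proj_id[OF B] B by (simp add: subspace_scale)
  moreover have "w \<in> B \<longleftrightarrow> c *\<^sub>R w \<in> B" for w
    using subspace_scale[OF B, of w c] subspace_scale[OF B, of "c *\<^sub>R w" "1 / c"] c(1) by auto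
  ultimately show ?thesis unfolding homothetic_on_def using c(1) by blast
next
  case False
  then obtain x0 where x0: "x0 \<in> B" "- x0 \<notin> B" by blast
  have "\<exists>z c. c \<noteq> 0 \<and> (\<forall>y\<in>span {u, v, w} \<inter> B. c *\<^sub>R y \<in> B \<and> h1 y = z \<bullet> y + h2 (c *\<^sub>R y))" for u v w
    using triples[of u v w] unfolding homothetic_on_def by blast
  from sublinear_homothetic_of_triples[OF h1 h2 x0 this]
  obtain z c where c: "c > 0" "\<forall>y\<in>B. h1 y = z \<bullet> y + h2 (c *\<^sub>R y)" by blast
  then show ?thesis unfolding homothetic_on_def
    using convex_cone_scaleR_iff[OF sublinear_onD(1)[OF h1] c(1)]
    by (intro exI[of _ z] exI[of _ c]) auto
qed

lemma homothetic_on_reflect: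
  "homothetic_on W B1 h1 (uminus ` B2) (\<lambda>u. h2 (- u)) \<longleftrightarrow> homothetic_on W B1 h1 B2 h2"
proof -
  have mem: "x \<in> uminus ` B2 \<longleftrightarrow> - x \<in> B2" for x
    by (metis image_eqI image_iff minus_minus)
  have *: "(\<exists>c. c \<noteq> 0 \<and> P (- c)) \<longleftrightarrow> (\<exists>c. c \<noteq> 0 \<and> P c)" for P :: "real \<Rightarrow> bool"
    by (metis minus_minus neg_equal_0_iff_equal)
  show ?thesis unfolding homothetic_on_def mem
    by (subst (2) *[symmetric]) simp
qed

text \<open>A vector that distinguishes \<open>B1\<close> from \<open>B2\<close> excludes positive ratios, and one that distinguishes
\<open>B1\<close> from \<open>- B2\<close> excludes negative ones; a span containing both leaves no ratio.\<close>

lemma homothetic_on_UNIV_of_triples: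
  fixes h1 h2 :: "'a::euclidean_space \<Rightarrow> real"
  assumes h1: "sublinear_on B1 h1" and h2: "sublinear_on B2 h2"
    and triples: "\<And>u v w. homothetic_on (span {u, v, w}) B1 h1 B2 h2"
  shows "homothetic_on UNIV B1 h1 B2 h2"
proof -
  have mem: "x \<in> uminus ` B2 \<longleftrightarrow> - x \<in> B2" for x
    by (metis image_eqI image_iff minus_minus)
  have "B1 = B2 \<or> B1 = uminus ` B2"
  proof (rule ccontr)
    assume "\<not> ?thesis"
    then obtain x y where x: "(x \<in> B1) \<noteq> (x \<in> B2)" and y: "(y \<in> B1) \<noteq> (- y \<in> B2)"
      using mem by blast
    obtain c where c: "c \<noteq> 0" "\<And>u. u \<in> span {x, y, y} \<Longrightarrow> u \<in> B1 \<longleftrightarrow> c *\<^sub>R u \<in> B2"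
      using triples[of x y y] unfolding homothetic_on_def by blast
    have "x \<in> B1 \<longleftrightarrow> c *\<^sub>R x \<in> B2" "y \<in> B1 \<longleftrightarrow> (- c) *\<^sub>R (- y) \<in> B2"
      using c(2) by (auto intro: span_base)
    then show False
      using convex_cone_scaleR_iff[OF sublinear_onD(1)[OF h2]] x y c(1)
      by (metis linorder_neqE_linordered_idom neg_0_less_iff_less)
  qed
  then show ?thesis
  proof
    assume "B1 = B2"
    then show ?thesis using homothetic_on_UNIV_same_domain h1 h2 triples by blast
  next
    assume B: "B1 = uminus ` B2"
    have "sublinear_on B1 (\<lambda>u. h2 (- u))"
      using h1 h2 unfolding sublinear_on_def by (auto simp: B) (metis add.commute)
    moreover have "homothetic_on (span {u, v, w}) B1 h1 B1 (\<lambda>u. h2 (- u))" for u v w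
      using triples[of u v w] homothetic_on_reflect[of _ B1 h1 B2 h2] unfolding B by blast
    ultimately have "homothetic_on UNIV B1 h1 B1 (\<lambda>u. h2 (- u))"
      using homothetic_on_UNIV_same_domain h1 by blast
    then show ?thesis using homothetic_on_reflect[of UNIV B1 h1 B2 h2] unfolding B by blast
  qed
qed

section \<open>Support functions of convex sets and of their projections\<close>

definition barrier_cone :: "'a::real_inner set \<Rightarrow> 'a set" where
  "barrier_cone K = {u. bdd_above ((\<bullet>) u ` K)}"

definition support_function :: "'a::real_inner set \<Rightarrow> 'a \<Rightarrow> real" where
  "support_function K u = Sup ((\<bullet>) u ` K)"

lemma support_upper: "u \<in> barrier_cone K \<Longrightarrow> x \<in> K \<Longrightarrow> u \<bullet> x \<le> support_function K u"
  unfolding barrier_cone_def support_function_def by (auto intro: cSup_upper)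

lemma barrier_cone_compact: "compact K \<Longrightarrow> barrier_cone K = UNIV"
  unfolding barrier_cone_def
  by (auto intro!: bounded_imp_bdd_above compact_imp_bounded compact_continuous_image
      continuous_intros)

lemma support_least:
  assumes "K \<noteq> {}" "\<And>x. x \<in> K \<Longrightarrow> u \<bullet> x \<le> t"
  shows "u \<in> barrier_cone K" "support_function K u \<le> t"
  using assms unfolding barrier_cone_def support_function_def by (auto intro!: cSup_least bdd_aboveI[of _ t])

lemma sublinear_support:
  assumes K: "K \<noteq> {}"
  shows "sublinear_on (barrier_cone K) (support_function K)"
proof -
  let ?B = "barrier_cone K" and ?h = "support_function K"
  have 0: "0 \<in> ?B" "?h 0 \<le> 0" using support_least[OF K, of 0 0] by auto
  have add: "x + y \<in> ?B" "?h (x + y) \<le> ?h x + ?h y" if "x \<in> ?B" "y \<in> ?B" for x y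
    using support_least[OF K, of "x + y" "?h x + ?h y"] support_upper[OF that(1)]
      support_upper[OF that(2)] by (simp_all add: inner_add_left add_mono)
  have scale_le: "c *\<^sub>R x \<in> ?B" "?h (c *\<^sub>R x) \<le> c * ?h x" if "x \<in> ?B" "c \<ge> 0" for c x
    using support_least[OF K, of "c *\<^sub>R x" "c * ?h x"] support_upper[OF that(1)] that(2)
    by (auto simp: mult_left_mono)
  have scale: "?h (c *\<^sub>R x) = c * ?h x" if x: "x \<in> ?B" and c: "c \<ge> 0" for c x
  proof (cases "c = 0")
    case True
    obtain p where "p \<in> K" using K by blast
    then have "?h 0 \<ge> 0" using support_upper[OF 0(1)] by fastforce
    then show ?thesis using True 0 by simp
  next
    case False
    then have "?h ((1 / c) *\<^sub>R (c *\<^sub>R x)) \<le> (1 / c) * ?h (c *\<^sub>R x)"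
      using scale_le(2)[OF scale_le(1)[OF x c], of "1 / c"] c by simp
    then show ?thesis using scale_le(2)[OF x c] False c by (simp add: field_simps)
  qed
  show ?thesis unfolding sublinear_on_def convex_cone_iff
    by (intro conjI ballI allI impI 0 add scale scale_le)
qed

lemma mem_iff_support:
  fixes K :: "'a::euclidean_space set"
  assumes K: "K \<noteq> {}" "closed K" "convex K"
  shows "x \<in> K \<longleftrightarrow> (\<forall>u\<in>barrier_cone K. u \<bullet> x \<le> support_function K u)"
proof
  assume R: "\<forall>u\<in>barrier_cone K. u \<bullet> x \<le> support_function K u"
  show "x \<in> K"
  proof (rule ccontr)
    assume "x \<notin> K"
    then obtain a b where ab: "a \<bullet> x < b" "\<forall>y\<in>K. b < a \<bullet> y"
      using separating_hyperplane_closed_point[OF K(3,2)] by blast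
    then have "(- a) \<bullet> y \<le> - b" if "y \<in> K" for y using that by force
    then have "- a \<in> barrier_cone K" "support_function K (- a) \<le> - b" using support_least[OF K(1)] by blast+
    then have "(- a) \<bullet> x \<le> - b" using R by force
    then show False using ab by simp
  qed
qed (simp add: support_upper)

text \<open>Only the values of the linear forms on the sets enter the support functions, so the comparison
covers both an affine image of \<open>K2\<close> and sets that are merely homothetic after projection.\<close>

lemma support_eq_of_values:
  assumes K: "K2 \<noteq> {}" and vals: "(\<bullet>) u ` K1 = (\<lambda>x. a + v \<bullet> x) ` K2"
  shows "u \<in> barrier_cone K1 \<longleftrightarrow> v \<in> barrier_cone K2"
    and "u \<in> barrier_cone K1 \<Longrightarrow> support_function K1 u = a + support_function K2 v"
proof -
  have K1: "K1 \<noteq> {}" using assms by auto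
  have 12: "\<exists>y\<in>K2. u \<bullet> x = a + v \<bullet> y" if "x \<in> K1" for x
    using imageI[OF that, of "(\<bullet>) u"] unfolding vals by (rule imageE) (rule bexI)
  have 21: "\<exists>x\<in>K1. u \<bullet> x = a + v \<bullet> y" if "y \<in> K2" for y
    using imageI[OF that, of "\<lambda>x. a + v \<bullet> x"] unfolding vals[symmetric] by (rule imageE) (rule bexI, simp)
  have A: "u \<in> barrier_cone K1" "support_function K1 u \<le> a + support_function K2 v" if v: "v \<in> barrier_cone K2"
  proof -
    have "u \<bullet> x \<le> a + support_function K2 v" if "x \<in> K1" for x
      using 12[OF that] support_upper[OF v] by force
    then show "u \<in> barrier_cone K1" "support_function K1 u \<le> a + support_function K2 v"
      using support_least[OF K1] by blast+
  qed
  have B: "v \<in> barrier_cone K2" "support_function K2 v \<le> support_function K1 u - a" if u: "u \<in> barrier_cone K1"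
  proof -
    have "v \<bullet> y \<le> support_function K1 u - a" if "y \<in> K2" for y
      using 21[OF that] support_upper[OF u] by force
    then show "v \<in> barrier_cone K2" "support_function K2 v \<le> support_function K1 u - a"
      using support_least[OF K] by blast+
  qed
  show "u \<in> barrier_cone K1 \<longleftrightarrow> v \<in> barrier_cone K2" using A B by blast
  show "support_function K1 u = a + support_function K2 v" if "u \<in> barrier_cone K1"
    using A B that by fastforce
qed

abbreviation support_homothetic_on :: "'a::real_inner set \<Rightarrow> 'a set \<Rightarrow> 'a set \<Rightarrow> bool" where
  "support_homothetic_on W K1 K2 \<equiv>
     homothetic_on W (barrier_cone K1) (support_function K1) (barrier_cone K2) (support_function K2)"

lemma homothetic_of_support:
  fixes K1 K2 :: "'a::euclidean_space set"
  assumes K1: "K1 \<noteq> {}" "closed K1" "convex K1" and K2: "K2 \<noteq> {}" "closed K2" "convex K2"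
    and hom: "support_homothetic_on UNIV K1 K2"
  shows "homothetic K1 K2"
proof -
  obtain z c where c: "c \<noteq> 0"
    and bar: "\<And>u. u \<in> barrier_cone K1 \<longleftrightarrow> c *\<^sub>R u \<in> barrier_cone K2"
    and sup: "\<And>u. u \<in> barrier_cone K1 \<Longrightarrow> support_function K1 u = z \<bullet> u + support_function K2 (c *\<^sub>R u)"
    using hom unfolding homothetic_on_def by blast
  let ?K = "(\<lambda>x. z + c *\<^sub>R x) ` K2"
  have "?K = (+) z ` ((\<lambda>x. c *\<^sub>R x) ` K2)" by (simp add: image_image)
  then have K: "?K \<noteq> {}" "closed ?K" "convex ?K"
    using K2 by (auto intro: closed_translation closed_scaling convex_translation convex_scaling)
  have "(\<bullet>) u ` ?K = (\<lambda>x. z \<bullet> u + (c *\<^sub>R u) \<bullet> x) ` K2" for u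
    by (simp add: image_image inner_add_right inner_commute)
  note K_sup = support_eq_of_values[OF K2(1) this]
  have b: "barrier_cone ?K = barrier_cone K1" using bar K_sup(1) by blast
  have s: "support_function ?K u = support_function K1 u" if "u \<in> barrier_cone K1" for u
    using sup[OF that] K_sup(2)[of u] that b by simp
  have "x \<in> K1 \<longleftrightarrow> x \<in> ?K" for x
    unfolding mem_iff_support[OF K1] mem_iff_support[OF K] b using s by auto
  then have "K1 = ?K" by blast
  then show ?thesis unfolding homothetic_def using K1(1) K2(1) c by blast
qed

lemma support_homothetic_on_of_projections:
  fixes K1 K2 :: "'a::euclidean_space set"
  assumes L: "subspace L" and K2: "K2 \<noteq> {}"
    and hom: "homothetic (orth_proj L ` K1) (orth_proj L ` K2)"
  shows "support_homothetic_on L K1 K2"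
proof -
  let ?\<pi> = "orth_proj L"
  obtain z c where c: "c \<noteq> 0" and eq: "?\<pi> ` K1 = (\<lambda>x. z + c *\<^sub>R x) ` ?\<pi> ` K2"
    using hom unfolding homothetic_def by blast
  have vals: "(\<bullet>) u ` K1 = (\<lambda>x. z \<bullet> u + (c *\<^sub>R u) \<bullet> x) ` K2" if u: "u \<in> L" for u
  proof -
    have \<pi>: "u \<bullet> ?\<pi> x = u \<bullet> x" for x using orth_proj_subspace(2)[OF L u] .
    have "(\<bullet>) u ` K1 = (\<bullet>) u ` ?\<pi> ` K1" by (simp add: image_image \<pi>)
    also have "\<dots> = (\<lambda>x. z \<bullet> u + (c *\<^sub>R u) \<bullet> x) ` K2"
      unfolding eq by (simp add: image_image inner_add_right \<pi> inner_commute)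
    finally show ?thesis .
  qed
  show ?thesis unfolding homothetic_on_def
  proof (intro exI[of _ z] exI[of _ c] conjI ballI impI)
    fix u assume u: "u \<in> L"
    show "u \<in> barrier_cone K1 \<longleftrightarrow> c *\<^sub>R u \<in> barrier_cone K2"
      by (rule support_eq_of_values(1)[OF K2 vals[OF u]])
    show "support_function K1 u = z \<bullet> u + support_function K2 (c *\<^sub>R u)" if "u \<in> barrier_cone K1"
      by (rule support_eq_of_values(2)[OF K2 vals[OF u] that])
  qed (rule c)
qed

lemma homothetic_orth_proj:
  fixes K1 K2 :: "'a::euclidean_space set"
  assumes L: "subspace L" and hom: "homothetic K1 K2"
  shows "homothetic (orth_proj L ` K1) (orth_proj L ` K2)"
proof -
  note lin = linear_orth_proj[OF L]
  obtain z c where *: "K1 \<noteq> {}" "K2 \<noteq> {}" "c \<noteq> 0" "K1 = (\<lambda>x. z + c *\<^sub>R x) ` K2"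
    using hom unfolding homothetic_def by blast
  then have "orth_proj L ` K1 = (\<lambda>x. orth_proj L z + c *\<^sub>R x) ` orth_proj L ` K2"
    by (simp add: image_image linear_add[OF lin] linear_scale[OF lin])
  then show ?thesis unfolding homothetic_def using * by blast
qed

lemma homothetic_on_mono: "homothetic_on W B1 h1 B2 h2 \<Longrightarrow> V \<subseteq> W \<Longrightarrow> homothetic_on V B1 h1 B2 h2"
  unfolding homothetic_on_def by blast

section \<open>Reduction of the projection condition to small spans\<close>

lemma subspace_between_of_dim:
  fixes T :: "'a::euclidean_space set"
  assumes "dim T \<le> k" "k \<le> DIM('a)"
  obtains L where "subspace L" "T \<subseteq> L" "dim L = k"
proof -
  obtain C where C: "C \<subseteq> T" "independent C" "T \<subseteq> span C" "card C = dim T"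
    using basis_exists by blast
  obtain D where D: "C \<subseteq> D" "independent D" "UNIV \<subseteq> span D"
    using maximal_independent_subset_extend[of C UNIV] C by auto
  have "card D = DIM('a)"
    using D(2,3) basis_card_eq_dim[of D UNIV] by (simp add: dim_UNIV)
  then obtain E where E: "C \<subseteq> E" "E \<subseteq> D" "card E = k"
    using exists_subset_between[of C k D] D C assms independent_imp_finite by metis
  have "independent E" using E D independent_mono by blast
  then have "dim (span E) = k" using E by (simp add: dim_eq_card_independent)
  moreover have "T \<subseteq> span E" using C E span_mono by blast
  ultimately show ?thesis using that[of "span E"] by simp
qed

text \<open>Two vectors at a time suffice for compact sets because their barrier cones are the whole space,
where the widths control the ratio.\<close>

lemma homothetic_of_pairs_compact:
  fixes K1 K2 :: "'a::euclidean_space set"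
  assumes K1: "K1 \<noteq> {}" "compact K1" "convex K1" and K2: "K2 \<noteq> {}" "compact K2" "convex K2"
    and pairs: "\<And>u v. support_homothetic_on (span {u, v}) K1 K2"
  shows "homothetic K1 K2"
proof (rule homothetic_of_support)
  have bar: "barrier_cone K1 = UNIV" "barrier_cone K2 = UNIV"
    by (rule barrier_cone_compact[OF K1(2)]) (rule barrier_cone_compact[OF K2(2)])
  have "sublinear_on UNIV (support_function K1)" "sublinear_on UNIV (support_function K2)"
    using sublinear_support[OF K1(1)] sublinear_support[OF K2(1)] unfolding bar .
  then have "\<exists>z c. c \<noteq> 0 \<and> (\<forall>w. support_function K1 w = z \<bullet> w + support_function K2 (c *\<^sub>R w))"
    by (rule sublinear_homothetic_of_pairs) (use pairs in \<open>simp add: homothetic_on_def bar\<close>)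
  then show "support_homothetic_on UNIV K1 K2" by (simp add: homothetic_on_def bar)
qed (use K1 K2 compact_imp_closed in auto)

lemma homothetic_of_triples_closed:
  fixes K1 K2 :: "'a::euclidean_space set"
  assumes K1: "K1 \<noteq> {}" "closed K1" "convex K1" and K2: "K2 \<noteq> {}" "closed K2" "convex K2"
    and triples: "\<And>u v w. support_homothetic_on (span {u, v, w}) K1 K2"
  shows "homothetic K1 K2"
  by (rule homothetic_of_support[OF K1 K2], rule homothetic_on_UNIV_of_triples)
    (rule sublinear_support[OF K1(1)] sublinear_support[OF K2(1)] triples)+

text \<open>The dimension count that removes \<open>S\<close> from the problem: some \<open>k\<close>-dimensional subspace contains
both \<open>S\<close> and \<open>T\<close>, and the relation known for all its directions restricts to the span of \<open>T\<close>.\<close>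

lemma support_homothetic_on_small_span:
  fixes K1 K2 S :: "'a::euclidean_space set"
  assumes K2: "K2 \<noteq> {}" and T: "finite T" "dim S + card T \<le> k" "k \<le> DIM('a)"
    and proj: "\<And>L. subspace L \<Longrightarrow> S \<subseteq> L \<Longrightarrow> dim L = k \<Longrightarrow>
      homothetic (orth_proj L ` K1) (orth_proj L ` K2)"
  shows "support_homothetic_on (span T) K1 K2"
proof -
  have "dim (S \<union> T) \<le> dim S + card T"
    using T(1)
  proof (induction T)
    case (insert t T)
    then show ?case using dim_insert[of t "S \<union> T"] by (auto split: if_splits)
  qed simp
  then have "dim (S \<union> T) \<le> k" using T(2) by linarith
  then obtain L where L: "subspace L" "S \<union> T \<subseteq> L" "dim L = k"
    using subspace_between_of_dim T(3) by blast
  have "S \<subseteq> L" "T \<subseteq> L" using L(2) by auto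
  have "support_homothetic_on L K1 K2"
    by (rule support_homothetic_on_of_projections[OF L(1) K2 proj[OF L(1) \<open>S \<subseteq> L\<close> L(3)]])
  then show ?thesis
    by (rule homothetic_on_mono) (rule span_minimal[OF \<open>T \<subseteq> L\<close> L(1)])
qed

theorem corollary1:
  fixes K1 K2 S :: "(real ^ 'n) set" and r m :: int
  assumes "K1 \<noteq> {}" and "K2 \<noteq> {}"
    and "convex K1" and "convex K2"
    and "subspace S" and "int (dim S) = r"
    and "(compact K1 \<and> compact K2 \<and>
            0 \<le> r \<and> r \<le> m - 2 \<and> m - 2 \<le> int CARD('n) - 3)
       \<or> (closed K1 \<and> closed K2 \<and>
            0 \<le> r \<and> r \<le> m - 3 \<and> m - 3 \<le> int CARD('n) - 4)"
  shows "homothetic K1 K2 \<longleftrightarrow>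
    (\<forall>L. plane_of_dim m L \<and> S \<subseteq> L \<longrightarrow>
       homothetic (orth_proj L ` K1) (orth_proj L ` K2))"
proof
  assume hom: "homothetic K1 K2"
  show "\<forall>L. plane_of_dim m L \<and> S \<subseteq> L \<longrightarrow> homothetic (orth_proj L ` K1) (orth_proj L ` K2)"
  proof (intro allI impI)
    fix L assume L: "plane_of_dim m L \<and> S \<subseteq> L"
    \<comment> \<open>A plane that contains \<open>S\<close> passes through the origin, so it is a linear subspace.\<close>
    then have "affine L" "0 \<in> L"
      using plane_of_dim_iff_affine subspace_0[OF assms(5)] by blast+
    then have "subspace L" using subspace_affine by blast
    then show "homothetic (orth_proj L ` K1) (orth_proj L ` K2)" using hom by (rule homothetic_orth_proj)
  qed
next
  assume proj: "\<forall>L. plane_of_dim m L \<and> S \<subseteq> L \<longrightarrow>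
    homothetic (orth_proj L ` K1) (orth_proj L ` K2)"
  have m: "0 \<le> m" "nat m \<le> DIM(real ^ 'n)" using assms(7) by auto
  have "plane_of_dim m L" if "subspace L" "dim L = nat m" for L :: "(real ^ 'n) set"
    unfolding plane_of_dim_def using that m(1) by (intro exI[of _ 0] exI[of _ L]) auto
  then have small: "support_homothetic_on (span T) K1 K2" if "finite T" "r + int (card T) \<le> m" for T
    using proj that assms(6)
    by (intro support_homothetic_on_small_span[OF assms(2) _ _ m(2), of T S]) auto
  have card: "card {u, v} \<le> 2" "card {u, v, w} \<le> 3" for u v w :: "real ^ 'n"
    by (simp_all add: card_insert_if)
  from assms(7) show "homothetic K1 K2"
  proof (elim disjE conjE)
    assume K: "compact K1" "compact K2" and rm: "r \<le> m - 2"
    have "support_homothetic_on (span {u, v}) K1 K2" for u v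
      by (rule small) (use card(1)[of u v] rm in auto)
    then show ?thesis using homothetic_of_pairs_compact assms(1-4) K by blast
  next
    assume K: "closed K1" "closed K2" and rm: "r \<le> m - 3"
    have "support_homothetic_on (span {u, v, w}) K1 K2" for u v w
      by (rule small) (use card(2)[of u v w] rm in auto)
    then show ?thesis using homothetic_of_triples_closed assms(1-4) K by blast
  qed
qed

end
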